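(* Let $n\ge 3$ and $r,k$ be integers with $2\le k\le r+1$ and $r\le n$, and let $j\in\mathbb{Z}_n$. Then the $r$-graph $G(n,r,k-1,j)$ is $H_k^r$-free.
   Context: Identify the vertices of the oriented cycle $C_n$ with $\mathbb{Z}_n$, with arcs $(x,x+1)$. For nonempty $B\subseteq\mathbb{Z}_n$, the diameter $d(B)$ is the length of the shortest directed path in $C_n$ passing through all elements of $B$, i.e. the least $\ell\ge0$ such that $B\subseteq\{x,x+1,\dots,x+\ell\}$ for some $x\in B$. For $t\le|A|$, $d_t(A)=\min\{d(B): B\subseteq A, |B|=t\}$. For $1\le t\le r$ and $j\in\mathbb{Z}_n$, $G(n,r,t,j)$ is the $r$-graph with vertex set $\mathbb{Z}_n$ whose edges are the $r$-element subsets $A\subseteq\mathbb{Z}_n$ such that $j+\sum_{x\in A}x$ (computed in $\mathbb{Z}_n$) belongs to $\{0,1,\dots,d_t(A)\}$. $H_k^r$ is the $r$-graph with $r+1$ vertices and $k$ edges; $G$ is $H$-free if it contains no subgraph isomorphic to $H$. *)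

theory Defs
  imports Main
begin

datatype 'a hypergraph = Hypergraph (verts: "'a set") (edges: "'a set set")

definition r_graph :: "nat \<Rightarrow> 'a hypergraph \<Rightarrow> bool" where
  "r_graph r G \<longleftrightarrow> finite (verts G) \<and> (\<forall>e\<in>edges G. e \<subseteq> verts G \<and> card e = r)"

definition subgraph :: "'a hypergraph \<Rightarrow> 'a hypergraph \<Rightarrow> bool" where
  "subgraph F G \<longleftrightarrow>
     verts F \<subseteq> verts G \<and> edges F \<subseteq> edges G \<and> (\<forall>e\<in>edges F. e \<subseteq> verts F)"

definition isomorphic :: "'a hypergraph \<Rightarrow> 'b hypergraph \<Rightarrow> bool" where
  "isomorphic F H \<longleftrightarrow>
     (\<exists>f. bij_betw f (verts F) (verts H) \<and> (\<lambda>e. f ` e) ` edges F = edges H)"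

definition free_of :: "'b hypergraph \<Rightarrow> 'a hypergraph \<Rightarrow> bool" where
  "free_of H G \<longleftrightarrow> \<not> (\<exists>F. subgraph F G \<and> isomorphic F H)"

(* A representative of H_k^r for k \<le> r + 1; the lemmas H_graph_r_graph and
   H_graph_unique show that it is, up to isomorphism, the only r-graph with
   r + 1 vertices and k edges. *)
definition H_graph :: "nat \<Rightarrow> nat \<Rightarrow> nat hypergraph" where
  "H_graph r k = Hypergraph {0..r} ((\<lambda>i. {0..r} - {i}) ` {0..<k})"

lemma H_graph_r_graph:
  assumes "k \<le> r + 1"
  shows "r_graph r (H_graph r k)" "card (verts (H_graph r k)) = r + 1"
    "card (edges (H_graph r k)) = k"
proof -
  show "r_graph r (H_graph r k)" "card (verts (H_graph r k)) = r + 1"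
    using assms by (auto simp: r_graph_def H_graph_def)
  have "inj_on (\<lambda>i. {0..r} - {i}) {0..<k}"
  proof (rule inj_onI)
    fix x y assume "x \<in> {0..<k}" and eq: "{0..r} - {x} = {0..r} - {y}"
    then have "x \<in> {0..r}" using assms by simp
    then show "x = y" using eq by blast
  qed
  then show "card (edges (H_graph r k)) = k"
    by (simp add: H_graph_def card_image)
qed

lemma H_graph_unique:
  assumes X: "r_graph r X" "card (verts X) = r + 1" "card (edges X) = k"
  shows "isomorphic X (H_graph r k)"
proof -
  define V where "V = verts X"
  define A where "A = {a\<in>V. V - {a} \<in> edges X}"
  have fin: "finite V" and cV: "card V = r + 1"
    using X by (auto simp: r_graph_def V_def)
  have AV: "A \<subseteq> V" by (auto simp: A_def)
  have E: "edges X = (\<lambda>a. V - {a}) ` A"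
  proof
    show "edges X \<subseteq> (\<lambda>a. V - {a}) ` A"
    proof
      fix e assume e: "e \<in> edges X"
      then have eV: "e \<subseteq> V" and ce: "card e = r"
        using X(1) by (auto simp: r_graph_def V_def)
      have "card (V - e) = 1"
        using card_Diff_subset[OF finite_subset[OF eV fin] eV] ce cV by simp
      then obtain a where a: "V - e = {a}" by (auto simp: card_1_singleton_iff)
      then have "e = V - {a}" "a \<in> V" using eV by auto
      then show "e \<in> (\<lambda>a. V - {a}) ` A" using e by (auto simp: A_def)
    qed
  qed (auto simp: A_def)
  have "inj_on (\<lambda>a. V - {a}) A" using AV by (auto simp: inj_on_def)
  then have cA: "card A = k" using X(3) by (simp add: E card_image)
  have finA: "finite A" using AV fin finite_subset by blast
  have kr: "k \<le> r + 1" using card_mono[OF fin AV] cA cV by simp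
  obtain g where g: "bij_betw g A {0..<k}"
    using ex_bij_betw_finite_nat[OF finA] cA by auto
  have "card (V - A) = card {k..r}"
    using card_Diff_subset[OF finA AV] cA cV by simp
  then obtain h where h: "bij_betw h (V - A) {k..r}"
    using finite_same_card_bij[of "V - A" "{k..r}"] fin by auto
  define f where "f a = (if a \<in> A then g a else h a)" for a
  have fA: "bij_betw f A {0..<k}"
    using g by (subst bij_betw_cong[of A f g]) (auto simp: f_def)
  have fB: "bij_betw f (V - A) {k..r}"
    using h by (subst bij_betw_cong[of "V - A" f h]) (auto simp: f_def)
  have "bij_betw f (A \<union> (V - A)) ({0..<k} \<union> {k..r})"
    by (rule bij_betw_combine[OF fA fB]) auto
  moreover have "A \<union> (V - A) = V" "{0..<k} \<union> {k..r} = {0..r}"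
    using AV kr by auto
  ultimately have fV: "bij_betw f V {0..r}" by simp
  have im: "f ` (V - {a}) = {0..r} - {f a}" if "a \<in> A" for a
  proof -
    have "inj_on f V" "f ` V = {0..r}" using fV by (auto simp: bij_betw_def)
    moreover have "a \<in> V" using AV that by blast
    ultimately show ?thesis using inj_on_image_set_diff[of f V V "{a}"] by auto
  qed
  have "(\<lambda>e. f ` e) ` edges X = (\<lambda>i. {0..r} - {i}) ` f ` A"
    by (simp add: E image_image im cong: image_cong)
  also have "f ` A = {0..<k}" using fA by (simp add: bij_betw_def)
  finally show ?thesis
    using fV unfolding isomorphic_def H_graph_def V_def by auto
qed

(* Z_n is represented by the residues {0..<n}, with addition modulo n. *)

definition diam :: "nat \<Rightarrow> nat set \<Rightarrow> nat" where
  "diam n B = (LEAST l. \<exists>x\<in>B. B \<subseteq> (\<lambda>i. (x + i) mod n) ` {0..l})"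

(* Meaningful for 1 \<le> t \<le> card A and finite A, where the minimum is over a
   finite nonempty family of nonempty sets. *)
definition diam_t :: "nat \<Rightarrow> nat \<Rightarrow> nat set \<Rightarrow> nat" where
  "diam_t n t A = Min (diam n ` {B. B \<subseteq> A \<and> card B = t})"

(* As diam_t n t A \<le> n - 1, the set {0..diam_t n t A} consists of distinct residues. *)
definition G_graph :: "nat \<Rightarrow> nat \<Rightarrow> nat \<Rightarrow> nat \<Rightarrow> nat hypergraph" where
  "G_graph n r t j = Hypergraph {0..<n}
     {A. A \<subseteq> {0..<n} \<and> card A = r \<and> (j + (\<Sum>x\<in>A. x)) mod n \<in> {0..diam_t n t A}}"

lemma G_graph_r_graph: "r_graph r (G_graph n r t j)"
  by (auto simp: r_graph_def G_graph_def)

end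

(* Suppose that W is a set of r + 1 residues and that W - {a} is an edge for all a in a set A of
   k elements of W. Put s = j + sum W and let m(a) be the residue of s - a, so that m(a) is at most
   d_{k-1}(W - {a}), which is at most d(A - {a}). Let m attain its maximum over A at a, and its
   maximum over A - {a} at b. The directed path from b to s has length m(b) and passes through
   all of A - {a}, so m(a) \<le> d(A - {a}) \<le> m(b) < m(a). *)
theory Submission
  imports Defs
begin

lemma diam_le:
  assumes "x \<in> B" "B \<subseteq> (\<lambda>i. (x + i) mod n) ` {0..l}"
  shows "diam n B \<le> l"
  unfolding diam_def using assms by (intro Least_le) blast

lemma diam_t_le:
  assumes "finite A" "B \<subseteq> A" "card B = t"
  shows "diam_t n t A \<le> diam n B"
  unfolding diam_t_def using assms by (intro Min_le) auto

lemma mod_add_cancel_less: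
  fixes a b m n :: nat
  assumes "(a + m) mod n = (b + m) mod n" "a < n" "b < n"
  shows "a = b"
proof -
  have "int n dvd int (a + m) - int (b + m)"
    using assms(1) by (metis mod_eq_dvd_iff of_nat_mod)
  then have "int a mod int n = int b mod int n"
    by (simp add: mod_eq_dvd_iff)
  then show ?thesis
    using assms(2,3) by simp
qed

lemma finite_has_max_value:
  fixes m :: "'a \<Rightarrow> 'b::linorder"
  assumes "A \<noteq> {}" "finite A"
  shows "\<exists>a\<in>A. \<forall>c\<in>A. m c \<le> m a"
proof -
  have "Max (m ` A) \<in> m ` A" using assms by (intro Max_in) auto
  then obtain a where "a \<in> A" "m a = Max (m ` A)" by auto
  then show ?thesis using assms(2) by (intro bexI[of _ a]) auto
qed

text \<open>All elements of \<open>B\<close> lead to the common end \<open>s\<close>, each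
  \<open>c\<close> after \<open>m c\<close> steps. The path of length \<open>m b\<close> from
  \<open>b\<close> to \<open>s\<close> starts farthest back, so it meets each \<open>c\<close> when
  \<open>m c\<close> steps remain, that is at position \<open>m b - m c\<close>.\<close>

lemma diam_le_distance_to_common_end:
  fixes m :: "nat \<Rightarrow> nat"
  assumes "b \<in> B" "B \<subseteq> {0..<n}"
    and m: "\<And>c. c \<in> B \<Longrightarrow> (c + m c) mod n = s mod n"
    and max: "\<And>c. c \<in> B \<Longrightarrow> m c \<le> m b"
  shows "diam n B \<le> m b"
proof (rule diam_le[OF \<open>b \<in> B\<close>], rule subsetI)
  fix c assume c: "c \<in> B"
  then have "c < n" using assms(2) by auto
  \<comment> \<open>The subtraction is not truncated, by maximality of \<open>m b\<close>. The inner
    \<open>mod n\<close> keeps the point on the path a residue, as cancelling \<open>m c\<close>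
    requires.\<close>
  have "((b + (m b - m c)) mod n + m c) mod n = (b + m b) mod n"
    using max[OF c] by (simp add: mod_simps)
  also have "\<dots> = (c + m c) mod n"
    using m[OF c] m[OF \<open>b \<in> B\<close>] by simp
  finally have "(b + (m b - m c)) mod n = c"
    by (rule mod_add_cancel_less) (use \<open>c < n\<close> in simp_all)
  then show "c \<in> (\<lambda>i. (b + i) mod n) ` {0..m b}"
    by (intro image_eqI[of _ _ "m b - m c"]) auto
qed

text \<open>The edges of \<open>H_graph r k\<close> are the complements of the vertices below
  \<open>k\<close>; \<open>A\<close> is the preimage of these vertices under the isomorphism. All
  that is needed of a copy is its vertex set and these \<open>k\<close> omitted vertices.\<close>

lemma H_graph_copyE:
  assumes sub: "subgraph F G" and iso: "isomorphic F (H_graph r k)" and "k \<le> r + 1"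
  obtains A where "A \<subseteq> verts F" "card A = k" "\<And>a. a \<in> A \<Longrightarrow> verts F - {a} \<in> edges G"
proof -
  obtain f where f: "bij_betw f (verts F) {0..r}"
    and E: "(\<lambda>e. f ` e) ` edges F = (\<lambda>i. {0..r} - {i}) ` {0..<k}"
    using iso by (auto simp: isomorphic_def H_graph_def)
  have inj: "inj_on f (verts F)" and img: "f ` verts F = {0..r}"
    using f by (auto simp: bij_betw_def)
  define A where "A = {a \<in> verts F. f a < k}"
  have "f ` A = {0..<k}"
  proof
    show "{0..<k} \<subseteq> f ` A"
    proof
      fix i assume i: "i \<in> {0..<k}"
      \<comment> \<open>The bound on \<open>k\<close> ensures that every \<open>i\<close> below
        \<open>k\<close> is a vertex of \<open>H_graph r k\<close>, so \<open>A\<close> has no fewer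
        than \<open>k\<close> elements.\<close>
      then have "i \<in> f ` verts F" using \<open>k \<le> r + 1\<close> img by auto
      then show "i \<in> f ` A" using i by (auto simp: A_def)
    qed
  qed (auto simp: A_def)
  moreover have "inj_on f A"
    using inj by (rule inj_on_subset) (auto simp: A_def)
  ultimately have "card A = k"
    using card_image by fastforce
  moreover have "verts F - {a} \<in> edges G" if "a \<in> A" for a
  proof -
    have a: "a \<in> verts F" "f a < k" using that by (auto simp: A_def)
    then have "{0..r} - {f a} \<in> (\<lambda>e. f ` e) ` edges F" by (simp add: E)
    then obtain e where e: "e \<in> edges F" "f ` e = {0..r} - {f a}" by auto
    \<comment> \<open>Since \<open>f\<close> is injective only on \<open>verts F\<close>, this
      inclusion is what allows \<open>e\<close> to be recovered from its image.\<close>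
    have "e \<subseteq> verts F" using sub e(1) by (auto simp: subgraph_def)
    moreover have "f ` (verts F - {a}) = {0..r} - {f a}"
      using inj_on_image_set_diff[OF inj, of "verts F" "{a}"] a(1) img by auto
    ultimately have "e = verts F - {a}"
      using inj e(2) by (metis Diff_subset inj_on_image_eq_iff)
    then show ?thesis using sub e(1) by (auto simp: subgraph_def)
  qed
  ultimately show thesis
    by (intro that[of A]) (auto simp: A_def)
qed

theorem theorem7:
  fixes n r k j :: nat
  assumes "3 \<le> n" and "2 \<le> k" and "k \<le> r + 1" and "r \<le> n" and "j \<in> {0..<n}"
  shows "free_of (H_graph r k) (G_graph n r (k - 1) j)"
  unfolding free_of_def
proof (rule notI, elim exE conjE)
  fix F
  assume sub: "subgraph F (G_graph n r (k - 1) j)" and iso: "isomorphic F (H_graph r k)"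
  define W where "W = verts F"
  obtain A where A: "A \<subseteq> W" "card A = k"
    and edge: "\<And>a. a \<in> A \<Longrightarrow> W - {a} \<in> edges (G_graph n r (k - 1) j)"
    using H_graph_copyE[OF sub iso \<open>k \<le> r + 1\<close>] unfolding W_def by blast
  have W: "W \<subseteq> {0..<n}"
    using sub by (auto simp: W_def subgraph_def G_graph_def)
  then have finW: "finite W" using finite_subset by blast
  with A(1) have finA: "finite A" using finite_subset by blast
  \<comment> \<open>This is the residue of \<open>j + \<Sum>W - a\<close>, written without
    subtraction on the naturals and exactly as in the edge condition for
    \<open>W - {a}\<close>.\<close>
  define m where "m a = (j + \<Sum>(W - {a})) mod n" for a
  have m: "(a + m a) mod n = (j + \<Sum>W) mod n" if "a \<in> A" for a
  proof -
    have "\<Sum>W = a + \<Sum>(W - {a})"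
      using that A(1) finW by (intro sum.remove) auto
    then show ?thesis by (simp add: m_def mod_simps ac_simps)
  qed
  have "A \<noteq> {}" using A(2) \<open>2 \<le> k\<close> by auto
  then have "\<exists>a\<in>A. \<forall>c\<in>A. m c \<le> m a"
    using finA by (intro finite_has_max_value)
  then obtain a where a: "a \<in> A" "\<And>c. c \<in> A \<Longrightarrow> m c \<le> m a"
    by blast
  define B where "B = A - {a}"
  have cardB: "card B = k - 1" using a(1) A(2) finA by (simp add: B_def)
  then have "B \<noteq> {}" using \<open>2 \<le> k\<close> by auto
  moreover have finB: "finite B" using finA by (simp add: B_def)
  ultimately have "\<exists>b\<in>B. \<forall>c\<in>B. m c \<le> m b"
    by (intro finite_has_max_value)
  then obtain b where b: "b \<in> B" "\<And>c. c \<in> B \<Longrightarrow> m c \<le> m b"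
    by blast
  have "m a \<le> diam_t n (k - 1) (W - {a})"
    using edge[OF a(1)] by (simp add: G_graph_def m_def)
  \<comment> \<open>\<open>B\<close> omits \<open>a\<close> and has \<open>k - 1\<close> elements,
    so it is one of the sets over which \<open>diam_t\<close> minimises.\<close>
  also have "\<dots> \<le> diam n B"
    using finW A(1) cardB by (intro diam_t_le) (auto simp: B_def)
  also have "\<dots> \<le> m b"
    using b A(1) W m by (intro diam_le_distance_to_common_end) (auto simp: B_def)
  \<comment> \<open>Maximality of \<open>m a\<close> turns the chain into an equality. This is
    absurd, since \<open>m\<close> is injective on \<open>A\<close>: equally long walks to the same
    end start at the same residue.\<close>
  finally have "m a = m b"
    using a(2)[of b] b(1) by (simp add: B_def)
  moreover have "(a + m a) mod n = (b + m b) mod n"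
    using m a(1) b(1) by (simp add: B_def)
  ultimately have "a = b"
    using a(1) b(1) A(1) W by (intro mod_add_cancel_less[of a "m a" n b]) (auto simp: B_def)
  then show False using b(1) by (simp add: B_def)
qed

end
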